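(* Let $p$ be an odd prime, $m\ge 1$, and let $\mathcal{P}$ be an integral point set over $\mathbb{E}_p^m$. Then all non-degenerate simplices of $\mathcal{P}$ (i.e. all sets of $m+1$ points of $\mathcal{P}$ with $V_m^2\neq 0$) have the same characteristic.
   Context: Let $p$ be an odd prime, $\mathbb{Z}_p=\mathbb{Z}/p\mathbb{Z}$, $\alpha(p)$ the smallest quadratic non-residue modulo $p$, and $K=\mathbb{Z}_p(\sqrt{\alpha(p)})$ the quadratic extension field. $\mathbb{E}_p^m$ is modelled by $K^m$, and an integral point set over $\mathbb{E}_p^m$ is a set of points of $K^m$ such that for any two distinct points $x=(x_1,\dots,x_m),y=(y_1,\dots,y_m)$ there is $\delta(x,y)\in\mathbb{Z}_p\setminus\{0\}$ with $\sum_{i=1}^m(x_i-y_i)^2=\delta(x,y)^2$ (and $\delta(x,x)=0$). For $m+1$ points $v_1,\dots,v_{m+1}$ with $\delta_{i,j}=\delta(v_i,v_j)$ let $$V_m^2=\det\begin{pmatrix}\delta_{1,1}^2&\cdots&\delta_{1,m+1}^2&1\\ \vdots&\ddots&\vdots&\vdots\\ \delta_{m+1,1}^2&\cdots&\delta_{m+1,m+1}^2&1\\ 1&\cdots&1&0\end{pmatrix}\in\mathbb{Z}_p.$$ The simplex is non-degenerate if $V_m^2\neq0$, and then its characteristic is $1$ if $V_m^2$ is a quadratic residue in $\mathbb{Z}_p$ and $\alpha(p)$ otherwise. *)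

theory Defs
  imports
    "Berlekamp_Zassenhaus.Finite_Field"
    "Jordan_Normal_Form.Determinant"
begin

section \<open>The field \<open>\<int>\<^sub>p(\<surd>\<alpha>(p))\<close>\<close>

text \<open>
  The prime \<open>p\<close> is \<open>CARD('p)\<close> for a type \<open>'p :: prime_card\<close>, and \<open>\<int>\<^sub>p\<close> is \<open>'p mod_ring\<close>.
\<close>

definition quadratic_residue :: "'p::prime_card mod_ring \<Rightarrow> bool" where
  "quadratic_residue a \<longleftrightarrow> QuadRes (int CARD('p)) (to_int_mod_ring a)"

text \<open>
  \<open>QuadRes p 0\<close> holds, so \<open>0\<close> is not a candidate for the smallest non-residue.
\<close>

definition smallest_nonresidue :: "nat \<Rightarrow> nat" where
  "smallest_nonresidue p = (LEAST n. \<not> QuadRes (int p) (int n))"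

definition alpha :: "'p::prime_card mod_ring" where
  "alpha = of_nat (smallest_nonresidue CARD('p))"

text \<open>
  \<open>Quad a b\<close> stands for \<open>a + b \<surd>\<alpha>(p)\<close>. For \<open>CARD('p) = 2\<close> there is no non-residue and
  \<open>alpha\<close> is unspecified; the type is then still a commutative ring. For odd \<open>CARD('p)\<close> it is
  a field, see \<open>quad_ext_inverse\<close> below.
\<close>

datatype 'p quad_ext = Quad (rat_part: "'p mod_ring") (rad_part: "'p mod_ring")

instantiation quad_ext :: (prime_card) comm_ring_1
begin

definition "0 = Quad 0 0"
definition "1 = Quad 1 0"
definition "x + y = Quad (rat_part x + rat_part y) (rad_part x + rad_part y)"
definition "x - y = Quad (rat_part x - rat_part y) (rad_part x - rad_part y)"
definition "- x = Quad (- rat_part x) (- rad_part x)"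
definition "x * y =
  Quad (rat_part x * rat_part y + alpha * (rad_part x * rad_part y))
       (rat_part x * rad_part y + rad_part x * rat_part y)"

instance
  by standard
    (auto simp: zero_quad_ext_def one_quad_ext_def plus_quad_ext_def minus_quad_ext_def
      uminus_quad_ext_def times_quad_ext_def algebra_simps)

end

definition of_base :: "'p::prime_card mod_ring \<Rightarrow> 'p quad_ext" where
  "of_base a = Quad a 0"

lemma of_base_add: "of_base (a + b) = of_base a + of_base b"
  and of_base_mult: "of_base (a * b) = of_base a * of_base b"
  and of_base_one: "of_base 1 = 1"
  and sqrt_alpha: "(Quad 0 1)\<^sup>2 = of_base alpha"
  and Quad_decompose: "Quad a b = of_base a + of_base b * Quad 0 1"
  by (simp_all add: of_base_def plus_quad_ext_def times_quad_ext_def one_quad_ext_def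
      power2_eq_square)

lemma quadratic_residue_iff: "quadratic_residue (a :: 'p::prime_card mod_ring) \<longleftrightarrow> (\<exists>y. y\<^sup>2 = a)"
proof
  assume "quadratic_residue a"
  then obtain y where "[y\<^sup>2 = to_int_mod_ring a] (mod int CARD('p))"
    by (auto simp: quadratic_residue_def QuadRes_def)
  then have "(of_int (y\<^sup>2) :: 'p mod_ring) = of_int (to_int_mod_ring a)"
    unfolding cong_def by (metis of_int_mod_CHAR semiring_char_mod_ring)
  then show "\<exists>y. y\<^sup>2 = a"
    by (metis of_int_of_int_mod_ring of_int_mod_ring_to_int_mod_ring of_int_power)
next
  assume "\<exists>y. y\<^sup>2 = a"
  then obtain y where "y\<^sup>2 = a" ..
  then have "[(to_int_mod_ring y)\<^sup>2 = to_int_mod_ring a] (mod int CARD('p))"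
    by (auto simp: power2_eq_square to_int_mod_ring_mult cong_def)
  then show "quadratic_residue a"
    by (auto simp: quadratic_residue_def QuadRes_def)
qed

lemma alpha_nonresidue:
  assumes "odd CARD('p::prime_card)"
  shows "\<not> quadratic_residue (alpha :: 'p mod_ring)"
proof -
  let ?sq = "\<lambda>y :: 'p mod_ring. y\<^sup>2"
  have "(2 :: 'p mod_ring) \<noteq> 0"
  proof
    assume "(2 :: 'p mod_ring) = 0"
    then have "CARD('p) dvd 2"
      using of_nat_0_mod_ring_dvd[where 'a = 'p and x = 2] by simp
    then have "CARD('p) = 2"
      by (rule primes_dvd_imp_eq[OF prime_card two_is_prime_nat])
    then have "even CARD('p)" by (rule ssubst) simp
    with assms show False by (rule notE)
  qed
  then have "(1 :: 'p mod_ring) \<noteq> - 1"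
    by (metis add.right_inverse one_add_one)
  moreover have "?sq 1 = ?sq (- 1)" by simp
  ultimately have "\<not> inj ?sq"
    by (metis injD)
  then have "\<not> surj ?sq"
    using finite_UNIV_surj_inj[of ?sq] by auto
  then obtain a :: "'p mod_ring" where a: "\<not> quadratic_residue a"
    unfolding quadratic_residue_iff by (metis surjI)
  have nonneg: "0 \<le> to_int_mod_ring a"
    using range_to_int_mod_ring[where 'a = 'p] by (metis atLeastLessThan_iff rangeI)
  have "\<not> QuadRes (int CARD('p)) (int (nat (to_int_mod_ring a)))"
    using a nonneg by (simp add: quadratic_residue_def)
  then have least: "\<not> QuadRes (int CARD('p)) (int (smallest_nonresidue CARD('p)))"
    unfolding smallest_nonresidue_def by (rule LeastI)
  have "to_int_mod_ring (alpha :: 'p mod_ring) = int (smallest_nonresidue CARD('p)) mod int CARD('p)"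
    unfolding alpha_def of_nat_of_int_mod_ring o_def by transfer simp
  with least show ?thesis
    by (simp add: quadratic_residue_def QuadRes_def cong_def)
qed

lemma quad_ext_inverse:
  fixes x :: "'p::prime_card quad_ext"
  assumes odd: "odd CARD('p)" and x: "x \<noteq> 0"
  shows "\<exists>y. x * y = 1"
proof -
  obtain a b where ab: "x = Quad a b" by (cases x)
  define N where "N = a\<^sup>2 - alpha * b\<^sup>2"
  have "N \<noteq> 0"
  proof
    assume N: "N = 0"
    show False
    proof (cases "b = 0")
      case True
      with N x ab show False by (simp add: N_def zero_quad_ext_def)
    next
      case False
      with N have "(a / b)\<^sup>2 = alpha" by (simp add: N_def power_divide)
      with alpha_nonresidue[OF odd] show False by (auto simp: quadratic_residue_iff)
    qed
  qed
  then have "x * Quad (a / N) (- b / N) = 1"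
    unfolding ab times_quad_ext_def one_quad_ext_def
    by (simp add: field_simps) (simp add: N_def power2_eq_square)
  then show ?thesis ..
qed

section \<open>Integral point sets and simplices\<close>

definition sq_dist :: "'p::prime_card quad_ext vec \<Rightarrow> 'p quad_ext vec \<Rightarrow> 'p quad_ext" where
  "sq_dist x y = (\<Sum>i<dim_vec x. (x $ i - y $ i)\<^sup>2)"

definition integral_point_set :: "nat \<Rightarrow> 'p::prime_card quad_ext vec set \<Rightarrow> bool" where
  "integral_point_set m P \<longleftrightarrow> P \<subseteq> carrier_vec m \<and>
     (\<forall>x\<in>P. \<forall>y\<in>P. x \<noteq> y \<longrightarrow> (\<exists>d. d \<noteq> 0 \<and> sq_dist x y = of_base (d\<^sup>2)))"

text \<open>
  The distances \<open>\<delta>(x,y)\<close> of an integral point set are determined only up to sign;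
  \<open>distance_on P \<delta>\<close> says that \<open>\<delta>\<close> is any admissible choice of them.
\<close>

definition distance_on ::
  "'p::prime_card quad_ext vec set \<Rightarrow> ('p quad_ext vec \<Rightarrow> 'p quad_ext vec \<Rightarrow> 'p mod_ring) \<Rightarrow> bool"
where
  "distance_on P \<delta> \<longleftrightarrow> (\<forall>x\<in>P. \<delta> x x = 0) \<and>
     (\<forall>x\<in>P. \<forall>y\<in>P. x \<noteq> y \<longrightarrow> \<delta> x y \<noteq> 0 \<and> sq_dist x y = of_base ((\<delta> x y)\<^sup>2))"

text \<open>
  \<open>V\<^sub>m\<^sup>2\<close> of the points listed in \<open>vs\<close> (of length \<open>m + 1\<close>), as the determinant of the bordered
  matrix of squared distances; the border has index \<open>m + 1\<close>.
\<close>

definition sq_volume ::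
  "('v \<Rightarrow> 'v \<Rightarrow> 'p::prime_card mod_ring) \<Rightarrow> nat \<Rightarrow> 'v list \<Rightarrow> 'p mod_ring"
where
  "sq_volume \<delta> m vs = det (mat (m + 2) (m + 2) (\<lambda>(i, j).
     if i \<le> m \<and> j \<le> m then (\<delta> (vs ! i) (vs ! j))\<^sup>2
     else if i \<le> m \<or> j \<le> m then 1
     else 0))"

text \<open>
  A set of \<open>m + 1\<close> points is given by an enumeration; \<open>sq_volume\<close> does not depend on
  the order, and all enumerations are admitted.
\<close>

definition nondegenerate_simplex ::
  "('v \<Rightarrow> 'v \<Rightarrow> 'p::prime_card mod_ring) \<Rightarrow> nat \<Rightarrow> 'v set \<Rightarrow> 'v list \<Rightarrow> bool"
where
  "nondegenerate_simplex \<delta> m P vs \<longleftrightarrow>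
     distinct vs \<and> length vs = m + 1 \<and> set vs \<subseteq> P \<and> sq_volume \<delta> m vs \<noteq> 0"

definition characteristic ::
  "('v \<Rightarrow> 'v \<Rightarrow> 'p::prime_card mod_ring) \<Rightarrow> nat \<Rightarrow> 'v list \<Rightarrow> 'p mod_ring"
where
  "characteristic \<delta> m vs = (if quadratic_residue (sq_volume \<delta> m vs) then 1 else alpha)"

end

theory Submission
  imports Defs
begin

text \<open>
  For two simplices \<open>v\<close> and \<open>w\<close>, let \<open>B(v,w)\<close> be the bordered matrix of the squared distances
  between the vertices of \<open>v\<close> and those of \<open>w\<close>. Since
  \<open>|x - y|\<^sup>2 = x \<cdot> (-2y) + |x|\<^sup>2 \<cdot> 1 + 1 \<cdot> |y|\<^sup>2\<close>, it factors as \<open>B(v,w) = L(v) R(w)\<close>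
  with square matrices, so \<open>det B(v,v) det B(w,w) = det B(v,w) det B(w,v) = (det B(v,w))\<^sup>2\<close>.
  All entries of \<open>B(v,w)\<close> are in \<open>\<int>\<^sub>p\<close>, hence the product of the two squared volumes is a square
  in \<open>\<int>\<^sub>p\<close>.
\<close>

text \<open>Two vertex lists allow the mixed matrix of two simplices, and the generic entry type
  covers \<open>sq_dist\<close> over the extension as well as the squares of \<delta> over the prime
  field.\<close>

definition bordered_mat :: "nat \<Rightarrow> ('v \<Rightarrow> 'v \<Rightarrow> 'a::zero_neq_one) \<Rightarrow> 'v list \<Rightarrow> 'v list \<Rightarrow> 'a mat"
where
  "bordered_mat m D vs ws = mat (m + 2) (m + 2) (\<lambda>(i, j).
     if i \<le> m \<and> j \<le> m then D (vs ! i) (ws ! j)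
     else if i \<le> m \<or> j \<le> m then 1
     else 0)"

definition sq_norm_sum :: "'a::comm_ring_1 vec \<Rightarrow> 'a" where
  "sq_norm_sum x = (\<Sum>i<dim_vec x. (x $ i)\<^sup>2)"

text \<open>The summation index \<open>k\<close> of the product has \<open>m\<close> coordinate
  slots, slot \<open>m\<close> for \<open>|x|\<^sup>2 \<cdot> 1\<close> and slot
  \<open>m + 1\<close> for \<open>1 \<cdot> |y|\<^sup>2\<close>. The border row of the left factor
  and the border column of the right one are unit vectors at the different slots \<open>m\<close>
  and \<open>m + 1\<close>: each reads off a constant 1 of the other factor, and their product is
  the corner 0.\<close>

definition left_factor :: "nat \<Rightarrow> 'a::comm_ring_1 vec list \<Rightarrow> 'a mat" where
  "left_factor m vs = mat (m + 2) (m + 2) (\<lambda>(i, k).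
     if i \<le> m then (if k < m then vs ! i $ k else if k = m then sq_norm_sum (vs ! i) else 1)
     else if k = m then 1 else 0)"

definition right_factor :: "nat \<Rightarrow> 'a::comm_ring_1 vec list \<Rightarrow> 'a mat" where
  "right_factor m ws = mat (m + 2) (m + 2) (\<lambda>(k, j).
     if j \<le> m then (if k < m then - 2 * ws ! j $ k else if k = m then 1 else sq_norm_sum (ws ! j))
     else if k = m + 1 then 1 else 0)"

lemma bordered_mat_cong:
  assumes "length vs = m + 1" "length ws = m + 1"
    and "\<And>x y. x \<in> set vs \<Longrightarrow> y \<in> set ws \<Longrightarrow> D x y = E x y"
  shows "bordered_mat m D vs ws = bordered_mat m E vs ws"
  unfolding bordered_mat_def using assms by (intro cong_mat) auto

lemma transpose_bordered_mat:
  "transpose_mat (bordered_mat m D vs ws) = bordered_mat m (\<lambda>x y. D y x) ws vs"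
  by (rule eq_matI) (auto simp: bordered_mat_def)

lemma sq_volume_eq_det_bordered_mat:
  "sq_volume \<delta> m vs = det (bordered_mat m (\<lambda>x y. (\<delta> x y)\<^sup>2) vs vs)"
  by (simp add: sq_volume_def bordered_mat_def)

lemma sq_dist_expand:
  assumes "x \<in> carrier_vec m" "y \<in> carrier_vec m"
  shows "sq_dist x y = (\<Sum>k<m. x $ k * (- 2 * y $ k)) + sq_norm_sum x + sq_norm_sum y"
  using assms
  by (auto simp: sq_dist_def sq_norm_sum_def power2_diff algebra_simps
      simp flip: sum.distrib sum_negf intro!: sum.cong)

lemma sq_dist_commute:
  assumes "x \<in> carrier_vec m" "y \<in> carrier_vec m"
  shows "sq_dist x y = sq_dist y x"
  using assms by (simp add: sq_dist_def power2_commute)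

lemma bordered_mat_sq_dist_eq_mult:
  assumes "length vs = m + 1" "length ws = m + 1"
    and "set vs \<subseteq> carrier_vec m" "set ws \<subseteq> carrier_vec m"
  shows "bordered_mat m sq_dist vs ws = left_factor m vs * right_factor m ws"
proof (rule eq_matI)
  fix i j
  assume "i < dim_row (left_factor m vs * right_factor m ws)"
    and "j < dim_col (left_factor m vs * right_factor m ws)"
  then have ij: "i < m + 2" "j < m + 2"
    by (auto simp: left_factor_def right_factor_def)
  have "(left_factor m vs * right_factor m ws) $$ (i, j) =
      (\<Sum>k<m + 2. left_factor m vs $$ (i, k) * right_factor m ws $$ (k, j))"
    using ij by (simp add: left_factor_def right_factor_def scalar_prod_def atLeast0LessThan)
  also have "\<dots> = bordered_mat m sq_dist vs ws $$ (i, j)"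
  proof (cases "i \<le> m \<and> j \<le> m")
    case True
    with assms have "vs ! i \<in> carrier_vec m" "ws ! j \<in> carrier_vec m"
      by (metis Suc_eq_plus1 less_Suc_eq_le nth_mem subsetD)+
    with True ij show ?thesis
      by (simp add: left_factor_def right_factor_def bordered_mat_def sq_dist_expand)
  next
    case False
    with ij show ?thesis
      by (auto simp: left_factor_def right_factor_def bordered_mat_def)
  qed
  finally show "bordered_mat m sq_dist vs ws $$ (i, j) =
      (left_factor m vs * right_factor m ws) $$ (i, j)" ..
qed (simp_all add: bordered_mat_def left_factor_def right_factor_def)

text \<open>Vertices plus border and coordinates plus two norm slots both number
  \<open>m + 2\<close>, so the factors are square and the determinant is multiplicative.\<close>

lemma det_bordered_mat_sq_dist:
  assumes "length vs = m + 1" "length ws = m + 1"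
    and "set vs \<subseteq> carrier_vec m" "set ws \<subseteq> carrier_vec m"
  shows "det (bordered_mat m sq_dist vs ws) = det (left_factor m vs) * det (right_factor m ws)"
  unfolding bordered_mat_sq_dist_eq_mult[OF assms]
  by (rule det_mult[of _ "m + 2"]) (simp_all add: left_factor_def right_factor_def)

lemma det_bordered_mat_sq_dist_mult:
  assumes "length vs = m + 1" "length ws = m + 1"
    and "set vs \<subseteq> carrier_vec m" "set ws \<subseteq> carrier_vec m"
  shows "det (bordered_mat m sq_dist vs vs) * det (bordered_mat m sq_dist ws ws) =
    (det (bordered_mat m sq_dist vs ws))\<^sup>2"
proof -
  \<comment> \<open>Symmetry of \<open>sq_dist\<close> turns the exchange of the two simplices into
    a transposition.\<close>
  have "bordered_mat m sq_dist ws vs = bordered_mat m (\<lambda>x y. sq_dist y x) ws vs"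
    using assms by (intro bordered_mat_cong) (auto intro: sq_dist_commute)
  also have "\<dots> = transpose_mat (bordered_mat m sq_dist vs ws)"
    by (simp add: transpose_bordered_mat)
  finally have "det (bordered_mat m sq_dist ws vs) = det (bordered_mat m sq_dist vs ws)"
    by (simp add: det_transpose[of _ "m + 2"] bordered_mat_def)
  moreover have "det (bordered_mat m sq_dist vs vs) * det (bordered_mat m sq_dist ws ws) =
      det (bordered_mat m sq_dist vs ws) * det (bordered_mat m sq_dist ws vs)"
    using assms by (simp add: det_bordered_mat_sq_dist mult_ac)
  ultimately show ?thesis by (simp add: power2_eq_square)
qed

interpretation of_base: comm_ring_hom "of_base :: 'p::prime_card mod_ring \<Rightarrow> 'p quad_ext"
  by standard
    (simp_all add: of_base_add of_base_mult of_base_one,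
      simp add: of_base_def zero_quad_ext_def)

lemma of_base_eq_iff: "of_base a = of_base b \<longleftrightarrow> a = b"
  by (simp add: of_base_def)

lemma sq_dist_eq_of_base:
  assumes "distance_on P \<delta>" "x \<in> P" "y \<in> P"
  shows "sq_dist x y = of_base ((\<delta> x y)\<^sup>2)"
proof (cases "x = y")
  \<comment> \<open>On the diagonal the value comes from the convention
    \<open>\<delta> x x = 0\<close>.\<close>
  case True
  with assms show ?thesis by (simp add: distance_on_def sq_dist_def)
next
  case False
  with assms show ?thesis by (simp add: distance_on_def)
qed

text \<open>The determinant is polynomial in the entries, so it commutes with the ring homomorphism
  \<open>of_base\<close>.\<close>

lemma of_base_det_bordered_mat:
  assumes "distance_on P \<delta>" "length vs = m + 1" "length ws = m + 1" "set vs \<subseteq> P" "set ws \<subseteq> P"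
  shows "of_base (det (bordered_mat m (\<lambda>x y. (\<delta> x y)\<^sup>2) vs ws)) =
    det (bordered_mat m sq_dist vs ws)"
proof -
  have "bordered_mat m sq_dist vs ws = bordered_mat m (\<lambda>x y. of_base ((\<delta> x y)\<^sup>2)) vs ws"
    using assms by (intro bordered_mat_cong) (auto intro: sq_dist_eq_of_base)
  also have "\<dots> = map_mat of_base (bordered_mat m (\<lambda>x y. (\<delta> x y)\<^sup>2) vs ws)"
    by (rule eq_matI) (auto simp: bordered_mat_def)
  finally show ?thesis by (simp add: of_base.hom_det)
qed

text \<open>The root \<open>c\<close> has to lie in the prime field, all of whose elements are
  already squares in the extension. The mixed determinant of the squares of \<delta> is such a root;
  injectivity of \<open>of_base\<close> brings the identity down.\<close>

lemma sq_volume_mult_is_square: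
  assumes "integral_point_set m P" "distance_on P \<delta>"
    and "length vs = m + 1" "length ws = m + 1" "set vs \<subseteq> P" "set ws \<subseteq> P"
  shows "\<exists>c. sq_volume \<delta> m vs * sq_volume \<delta> m ws = c\<^sup>2"
proof -
  have "set vs \<subseteq> carrier_vec m" "set ws \<subseteq> carrier_vec m"
    using assms by (auto simp: integral_point_set_def)
  with assms have "of_base (sq_volume \<delta> m vs * sq_volume \<delta> m ws) =
      of_base ((det (bordered_mat m (\<lambda>x y. (\<delta> x y)\<^sup>2) vs ws))\<^sup>2)"
    by (simp add: sq_volume_eq_det_bordered_mat of_base_mult of_base.hom_power
        of_base_det_bordered_mat det_bordered_mat_sq_dist_mult)
  then show ?thesis by (auto simp: of_base_eq_iff)
qed

text \<open>A square root \<open>y\<close> of \<open>a\<close> is invertible because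
  \<open>a\<close> is nonzero, so \<open>c / y\<close> is a square root of \<open>b\<close>.\<close>

lemma quadratic_residue_of_mult_square:
  assumes "a * b = c\<^sup>2" "a \<noteq> 0" "quadratic_residue a"
  shows "quadratic_residue b"
proof -
  obtain y where y: "y\<^sup>2 = a"
    using assms by (auto simp: quadratic_residue_iff)
  with assms have "(c / y)\<^sup>2 = b"
    by (auto simp: power_divide field_simps)
  then show ?thesis by (auto simp: quadratic_residue_iff)
qed

theorem theorem8:
  fixes P :: "'p::prime_card quad_ext vec set"
    and \<delta> :: "'p quad_ext vec \<Rightarrow> 'p quad_ext vec \<Rightarrow> 'p mod_ring"
    and m :: nat
  assumes "odd CARD('p)"
    and "m \<ge> 1"
    and "integral_point_set m P"
    and "distance_on P \<delta>"
    and "nondegenerate_simplex \<delta> m P vs"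
    and "nondegenerate_simplex \<delta> m P ws"
  shows "characteristic \<delta> m vs = characteristic \<delta> m ws"
proof -
  obtain c where c: "sq_volume \<delta> m vs * sq_volume \<delta> m ws = c\<^sup>2"
    using sq_volume_mult_is_square[of m P \<delta> vs ws] assms
    by (auto simp: nondegenerate_simplex_def)
  \<comment> \<open>Residuosity passes from the first factor to the second; the swapped product
    gives the converse.\<close>
  then have "sq_volume \<delta> m ws * sq_volume \<delta> m vs = c\<^sup>2"
    by (simp add: mult.commute)
  moreover have "sq_volume \<delta> m vs \<noteq> 0" "sq_volume \<delta> m ws \<noteq> 0"
    using assms by (auto simp: nondegenerate_simplex_def)
  ultimately have "quadratic_residue (sq_volume \<delta> m vs) \<longleftrightarrow> quadratic_residue (sq_volume \<delta> m ws)"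
    using c quadratic_residue_of_mult_square by metis
  then show ?thesis by (simp add: characteristic_def)
qed

end
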